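(* Let $\rho_0,\rho_T\in\mathcal{P}$ be such that $\Phi(\rho_0)$ belongs to the interior of $K$ (the interior being taken relative to the affine hyperplane $W_0$) and $\mathrm{Tr}\big((\mathrm{Tr}_A\rho_T)^2\big)=1$. Then there is no essentially bounded control function $u=(u_1,u_2,u_3)$ that steers $\rho_0$ to $\rho_T$ in finite time along the controlled master equation $$\dot\rho=-i[H(u(t)),\rho]+\mathcal{L}(\rho)$$ described in the context.
   Context: Two-qubit system: the Hilbert space is $\mathcal{H}=\mathcal{H}_A\otimes\mathcal{H}_B$ with $\mathcal{H}_A=\mathcal{H}_B=\mathbb{C}^2$; $\mathcal{P}$ is the set of density matrices on $\mathcal{H}\cong\mathbb{C}^4$ (Hermitian, positive semidefinite, trace one); $\mathrm{Tr}_A$ is the partial trace over $\mathcal{H}_A$, so $\mathrm{Tr}_A\rho$ is a density matrix on $\mathcal{H}_B$. Hamiltonian: $H(u)=\big(h_{A_0}+\sum_{j=1}^3u_jh_{A_j}\big)\otimes I_2+H_I+I_2\otimes h_B$, where $h_{A_0},\dots,h_{A_3},h_B$ are constant traceless Hermitian $2\times2$ matrices, $H_I$ is a constant element of the tensor product of the space of traceless Hermitian $2\times 2$ matrices with itself, and the $u_j$ are real-valued functions of time. Dissipation: $\mathcal{L}(\rho)=\sum_k\big(L_k\rho L_k^\dagger-\tfrac12L_k^\dagger L_k\rho-\tfrac12\rho L_k^\dagger L_k\big)$, a finite sum with $L_k=\ell_k\otimes I_2$, each $\ell_k$ a traceless complex $2\times2$ matrix. Coherence representation: let $\Lambda_1,\dots,\Lambda_{15}$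 be an orthonormal basis (for $\langle X,Y\rangle=\mathrm{Tr}(X^\dagger Y)$) of the traceless Hermitian $4\times4$ matrices. Define $\Phi:\mathcal{P}\to\mathbb{R}^{16}$ by $\Phi(\rho)=\big(\tfrac12,\mathrm{Tr}(\rho\Lambda_1),\dots,\mathrm{Tr}(\rho\Lambda_{15})\big)$, $K=\Phi(\mathcal{P})$, and $W_0=\{(\tfrac12,v):v\in\mathbb{R}^{15}\}$. *)

theory Defs
  imports "HOL-Analysis.Analysis"
begin

text \<open>Two-qubit operators are indexed by pairs: the first component of an index belongs to
  \<open>\<H>\<^sub>A\<close>, the second one to \<open>\<H>\<^sub>B\<close>.\<close>

type_synonym qubit_op = "complex ^ 2 ^ 2"
type_synonym two_qubit_op = "complex ^ (2 \<times> 2) ^ (2 \<times> 2)"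

definition adjoint_matrix :: "complex ^ 'n ^ 'm \<Rightarrow> complex ^ 'm ^ 'n"
  where "adjoint_matrix A = map_matrix cnj (transpose A)"

definition hermitian :: "complex ^ 'n ^ 'n \<Rightarrow> bool"
  where "hermitian A \<longleftrightarrow> adjoint_matrix A = A"

definition traceless_hermitian :: "(complex ^ 'n ^ 'n) set"
  where "traceless_hermitian = {A. hermitian A \<and> trace A = 0}"

text \<open>\<open>Re\<close> loses nothing here, since the quadratic form of a Hermitian matrix is real.\<close>

definition positive_semidefinite :: "complex ^ 'n ^ 'n \<Rightarrow> bool"
  where "positive_semidefinite A \<longleftrightarrow>
    hermitian A \<and> (\<forall>v. 0 \<le> Re (\<Sum>i\<in>UNIV. cnj (v $ i) * (A *v v) $ i))"

definition density_matrices :: "(complex ^ 'n ^ 'n) set"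
  where "density_matrices = {\<rho>. positive_semidefinite \<rho> \<and> trace \<rho> = 1}"

definition tensor_op :: "qubit_op \<Rightarrow> qubit_op \<Rightarrow> two_qubit_op"
  where "tensor_op A B = (\<chi> i j. A $ fst i $ fst j * B $ snd i $ snd j)"

definition partial_trace_A :: "two_qubit_op \<Rightarrow> qubit_op"
  where "partial_trace_A \<rho> = (\<chi> k l. \<Sum>i\<in>UNIV. \<rho> $ (i, k) $ (i, l))"

text \<open>The span is over the reals.\<close>

definition traceless_hermitian_tensor :: "two_qubit_op set"
  where "traceless_hermitian_tensor =
    span {tensor_op A B | A B. A \<in> traceless_hermitian \<and> B \<in> traceless_hermitian}"

definition hamiltonian ::
  "qubit_op \<Rightarrow> (3 \<Rightarrow> qubit_op) \<Rightarrow> two_qubit_op \<Rightarrow> qubit_op \<Rightarrow> real ^ 3 \<Rightarrow> two_qubit_op"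
  where "hamiltonian hA0 hA HI hB u =
    tensor_op (hA0 + (\<Sum>j\<in>UNIV. (u $ j) *\<^sub>R hA j)) (mat 1) + HI + tensor_op (mat 1) hB"

definition dissipator :: "nat \<Rightarrow> (nat \<Rightarrow> two_qubit_op) \<Rightarrow> two_qubit_op \<Rightarrow> two_qubit_op"
  where "dissipator n L \<rho> =
    (\<Sum>k<n. L k ** \<rho> ** adjoint_matrix (L k)
      - (1 / 2) *\<^sub>R (adjoint_matrix (L k) ** L k ** \<rho>)
      - (1 / 2) *\<^sub>R (\<rho> ** adjoint_matrix (L k) ** L k))"

definition master_rhs ::
  "two_qubit_op \<Rightarrow> nat \<Rightarrow> (nat \<Rightarrow> two_qubit_op) \<Rightarrow> two_qubit_op \<Rightarrow> two_qubit_op"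
  where "master_rhs H n L \<rho> = map_matrix ((*) (- \<i>)) (H ** \<rho> - \<rho> ** H) + dissipator n L \<rho>"

definition essentially_bounded_on :: "real set \<Rightarrow> (real \<Rightarrow> 'a::euclidean_space) \<Rightarrow> bool"
  where "essentially_bounded_on S u \<longleftrightarrow>
    u \<in> borel_measurable (lebesgue_on S) \<and> (\<exists>C. AE t in lebesgue_on S. norm (u t) \<le> C)"

text \<open>Absolute continuity of a function of a real variable: each \<open>\<D>\<close> below is a finite
  family of nonoverlapping compact intervals contained in \<open>{a..b}\<close>.\<close>

definition absolutely_continuous_on_interval ::
  "real \<Rightarrow> real \<Rightarrow> (real \<Rightarrow> 'a::real_normed_vector) \<Rightarrow> bool"
  where "absolutely_continuous_on_interval a b f \<longleftrightarrow>
    (\<forall>\<epsilon>>0. \<exists>\<delta>>0. \<forall>\<D> S. \<D> division_of S \<longrightarrow> S \<subseteq> {a..b} \<longrightarrow>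
      (\<Sum>I\<in>\<D>. Sup I - Inf I) < \<delta> \<longrightarrow> (\<Sum>I\<in>\<D>. norm (f (Sup I) - f (Inf I))) < \<epsilon>)"

text \<open>Since the controls are only measurable, solutions are meant in the sense of Caratheodory.\<close>

definition caratheodory_solution ::
  "real \<Rightarrow> (real \<Rightarrow> 'a \<Rightarrow> 'a) \<Rightarrow> (real \<Rightarrow> 'a::real_normed_vector) \<Rightarrow> bool"
  where "caratheodory_solution T F x \<longleftrightarrow>
    absolutely_continuous_on_interval 0 T x \<and>
    (AE t in lebesgue_on {0..T}. (x has_vector_derivative F t (x t)) (at t within {0..T}))"

definition steers ::
  "real \<Rightarrow> ('u \<Rightarrow> 'a \<Rightarrow> 'a) \<Rightarrow> (real \<Rightarrow> 'u) \<Rightarrow> 'a::real_normed_vector \<Rightarrow> 'a \<Rightarrow> bool"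
  where "steers T F u x0 x1 \<longleftrightarrow>
    (\<exists>x. caratheodory_solution T (\<lambda>t. F (u t)) x \<and> x 0 = x0 \<and> x T = x1)"

definition orthonormal_basis_traceless_hermitian :: "(15 \<Rightarrow> two_qubit_op) \<Rightarrow> bool"
  where "orthonormal_basis_traceless_hermitian \<Lambda> \<longleftrightarrow>
    (\<forall>i j. trace (adjoint_matrix (\<Lambda> i) ** \<Lambda> j) = (if i = j then 1 else 0)) \<and>
    span (range \<Lambda>) = traceless_hermitian"

text \<open>The space \<open>\<real>\<^sup>1\<^sup>6\<close> is represented as \<open>\<real> \<times> \<real>\<^sup>1\<^sup>5\<close>; \<open>1 / 2\<close> is the component of
  a state along the normalized identity. The traces below are real for Hermitian arguments.\<close>

definition coherence_vector :: "(15 \<Rightarrow> two_qubit_op) \<Rightarrow> two_qubit_op \<Rightarrow> real \<times> (real ^ 15)"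
  where "coherence_vector \<Lambda> \<rho> = (1 / 2, \<chi> j. Re (trace (\<rho> ** \<Lambda> j)))"

definition coherence_hyperplane :: "(real \<times> (real ^ 15)) set"
  where "coherence_hyperplane = {(1 / 2, v) | v. True}"

end

theory Submission
  imports Defs
begin

text \<open>Write \<open>m(t)\<close> for the least eigenvalue of the state \<open>x(t)\<close>. With \<open>G = -iH - 1/2 \<Sum> L\<^sub>k\<^sup>\<dagger> L\<^sub>k\<close> the
  equation reads \<open>x' = G x + x G\<^sup>\<dagger> + \<Sum> L\<^sub>k x L\<^sub>k\<^sup>\<dagger>\<close>, so an infinitesimal step is a congruence by
  \<open>1 + h G\<close> plus a positive term. Hence \<open>m' \<ge> - c m\<close> almost everywhere as long as \<open>m \<ge> 0\<close>, where \<open>c\<close>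
  bounds \<open>\<Sum> |L\<^sub>k v|\<^sup>2\<close> over unit vectors \<open>v\<close>; since \<open>m\<close> is absolutely continuous, it cannot
  reach zero in finite time. An interior state has \<open>m > 0\<close>, whereas a state whose partial trace is pure
  is singular.\<close>

section \<open>Absolutely continuous functions\<close>

text \<open>Translates the length sum in the definition of absolute continuity into a Lebesgue
  measure, so that a cover by a small open set can be used to bound it.\<close>

lemma sum_length_division:
  assumes "\<D> division_of S"
  shows "(\<Sum>I\<in>\<D>. Sup I - Inf I) = measure lebesgue (S :: real set)"
proof -
  have 1: "((\<lambda>x. 1::real) has_integral (Sup I - Inf I)) I" if I: "I \<in> \<D>" for I
  proof -
    obtain a b where "I = {a..b}" "I \<noteq> {}"
      using division_ofD(3,4)[OF assms I] by auto
    then show ?thesis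
      using has_integral_const_real[of "1::real" a b] by auto
  qed
  have "((\<lambda>x. 1::real) has_integral (\<Sum>I\<in>\<D>. Sup I - Inf I)) S"
    using has_integral_combine_division[OF assms 1] .
  then show ?thesis
    using assms lmeasure_integral lmeasurable_division by (metis integral_unique)
qed

text \<open>A mean value inequality with an exceptional null set, proved by a fine tagged partition
  as in Henstock-Kurzweil integration. Intervals tagged outside \<open>N\<close> obey the straddle
  estimate \<open>lower\<close>. Those tagged in \<open>N\<close> have small total length, so
  absolute continuity makes their contribution small. No derivative of \<open>f\<close> occurs,
  which suits a least eigenvalue, as it need not be differentiable.\<close>

lemma ac_increment_ge:
  fixes f :: "real \<Rightarrow> real"
  assumes "a \<le> b" and ac: "absolutely_continuous_on_interval a b f"
    and N: "negligible N"
    and lower: "\<And>\<tau> e. \<tau> \<in> {a..b} - N \<Longrightarrow> 0 < e \<Longrightarrow>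
      \<exists>d>0. \<forall>s t. a \<le> s \<longrightarrow> s \<le> \<tau> \<longrightarrow> \<tau> \<le> t \<longrightarrow> t \<le> b \<longrightarrow> \<bar>s - \<tau>\<bar> < d \<longrightarrow> \<bar>t - \<tau>\<bar> < d \<longrightarrow>
        - (K + e) * (t - s) \<le> f t - f s"
  shows "- K * (b - a) \<le> f b - f a"
proof -
  \<comment> \<open>The three parts of the error factor: \<open>1\<close> bounds the variation of
    \<open>f\<close> over the bad intervals, \<open>\<bar>K + e\<bar>\<close> pays for the length
    missing there, and \<open>b - a\<close> for replacing \<open>K\<close> by
    \<open>K + e\<close>.\<close>
  have *: "- K * (b - a) \<le> f b - f a + e * (1 + \<bar>K + e\<bar> + (b - a))" if e: "0 < e" for e
  proof -
    obtain \<delta> where "\<delta> > 0" and \<delta>: "\<And>\<D> S. \<lbrakk>\<D> division_of S; S \<subseteq> {a..b};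
        (\<Sum>I\<in>\<D>. Sup I - Inf I) < \<delta>\<rbrakk> \<Longrightarrow> (\<Sum>I\<in>\<D>. norm (f (Sup I) - f (Inf I))) < e"
      using ac e unfolding absolutely_continuous_on_interval_def by meson
    have "N \<in> sets lebesgue" "N \<in> null_sets lebesgue"
      using N negligible_iff_null_sets by auto
    \<comment> \<open>The bound \<open>\<delta>\<close> makes absolute continuity applicable to
      intervals inside \<open>U\<close>; the bound \<open>e\<close> keeps their total length
      small.\<close>
    then obtain U where U: "open U" "N \<subseteq> U" "U - N \<in> lmeasurable"
        "emeasure lebesgue (U - N) < ennreal (min e \<delta>)"
      using sets_lebesgue_outer_open[of N "min e \<delta>"] e \<open>\<delta> > 0\<close> by auto
    have "U = (U - N) \<union> N"
      using U by auto
    then have U_meas: "U \<in> lmeasurable"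
      by (metis U(3) N negligible_imp_measurable fmeasurable.Un)
    have "emeasure lebesgue U = emeasure lebesgue (U - N)"
      using \<open>N \<in> null_sets lebesgue\<close> U_meas by (simp add: emeasure_Diff_null_set fmeasurableD)
    then have U_small: "measure lebesgue U < min e \<delta>"
      using U(4) U_meas e \<open>\<delta> > 0\<close>
      by (metis emeasure_eq_measure2 ennreal_less_iff measure_nonneg)
    \<comment> \<open>The gauge keeps intervals tagged in \<open>N\<close> inside \<open>U\<close>, where \<open>f\<close> varies by less than \<open>e\<close>.\<close>
    have "\<exists>d>0. (\<tau> \<in> N \<longrightarrow> ball \<tau> d \<subseteq> U) \<and> (\<tau> \<in> {a..b} - N \<longrightarrow>
        (\<forall>s t. a \<le> s \<longrightarrow> s \<le> \<tau> \<longrightarrow> \<tau> \<le> t \<longrightarrow> t \<le> b \<longrightarrow> \<bar>s - \<tau>\<bar> < d \<longrightarrow> \<bar>t - \<tau>\<bar> < d \<longrightarrow>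
          - (K + e) * (t - s) \<le> f t - f s))" for \<tau>
    proof (cases "\<tau> \<in> N")
      case True
      then show ?thesis
        using U by (auto simp: open_contains_ball)
    next
      case False
      then show ?thesis
        using lower[of \<tau> e] e by (cases "\<tau> \<in> {a..b}") (auto intro: zero_less_one)
    qed
    then obtain r where r: "\<And>\<tau>. 0 < r \<tau>" "\<And>\<tau>. \<tau> \<in> N \<Longrightarrow> ball \<tau> (r \<tau>) \<subseteq> U"
      and r_good: "\<And>\<tau> s t. \<lbrakk>\<tau> \<in> {a..b} - N; a \<le> s; s \<le> \<tau>; \<tau> \<le> t; t \<le> b; \<bar>s - \<tau>\<bar> < r \<tau>; \<bar>t - \<tau>\<bar> < r \<tau>\<rbrakk>
          \<Longrightarrow> - (K + e) * (t - s) \<le> f t - f s"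
      by metis
    have "gauge (\<lambda>\<tau>. ball \<tau> (r \<tau>))"
      using r by (intro gauge_ball_dependent) auto
    then obtain p where p: "p tagged_division_of {a..b}" and fine: "(\<lambda>\<tau>. ball \<tau> (r \<tau>)) fine p"
      using fine_division_exists_real by blast
    note pD = tagged_division_ofD[OF p]
    have ends: "Inf J \<in> J \<and> Sup J \<in> J \<and> Inf J \<le> \<tau> \<and> \<tau> \<le> Sup J \<and> J \<subseteq> ball \<tau> (r \<tau>) \<and> J \<subseteq> {a..b}"
      if J: "(\<tau>, J) \<in> p" for \<tau> J
    proof -
      obtain c d where "J = {c..d}"
        using pD(4)[OF J] by auto
      then show ?thesis
        using pD(2,3)[OF J] fine J by (auto simp: fine_def)
    qed
    define B where "B = {z \<in> p. fst z \<in> N}"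
    define D where "D = snd ` B"
    have B: "B tagged_partial_division_of {a..b}"
      using p B_def unfolding tagged_division_of_def by (auto intro: tagged_partial_division_subset)
    note div = partial_division_of_tagged_division[OF B, folded D_def]
    have D_ab: "\<Union>D \<subseteq> {a..b}"
      using pD(3) unfolding D_def B_def by force
    have "\<Union>D \<subseteq> U"
      using ends r(2) unfolding D_def B_def by fastforce
    then have "measure lebesgue (\<Union>D) \<le> measure lebesgue U"
      using U_meas div lmeasurable_division by (metis measure_mono_fmeasurable fmeasurableD)
    then have D_small: "(\<Sum>I\<in>D. Sup I - Inf I) < min e \<delta>"
      using sum_length_division[OF div] U_small by linarith
    then have D_var: "(\<Sum>I\<in>D. norm (f (Sup I) - f (Inf I))) < e"
      using \<delta>[OF div D_ab] by linarith
    have sum_B: "(\<Sum>(\<tau>, J)\<in>B. g (Sup J) (Inf J)) = (\<Sum>I\<in>D. g (Sup I) (Inf I))"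
      if g: "\<And>z. g z z = 0" for g :: "real \<Rightarrow> real \<Rightarrow> real"
    proof -
      \<comment> \<open>The case distinction provides the vanishing on intervals with empty interior
        that \<open>sum.over_tagged_division_lemma\<close> requires. It changes no value, because a
        degenerate interval contributes \<open>g z z = 0\<close>.\<close>
      have "(\<Sum>(\<tau>, J)\<in>B. if interior J = {} then 0 else g (Sup J) (Inf J)) =
          (\<Sum>I\<in>D. if interior I = {} then 0 else g (Sup I) (Inf I))"
        unfolding D_def
        by (rule sum.over_tagged_division_lemma[OF tagged_partial_division_of_Union_self[OF B]]) auto
      moreover have nontrivial: "(if interior I = {} then 0 else g (Sup I) (Inf I)) = g (Sup I) (Inf I)"
        if I: "I \<in> D" for I
      proof -
        obtain c d where "I = {c..d}" "I \<noteq> {}"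
          using division_ofD(3,4)[OF div I] by auto
        then show ?thesis
          using g by auto
      qed
      moreover have "(\<Sum>(\<tau>, J)\<in>B. if interior J = {} then 0 else g (Sup J) (Inf J)) =
          (\<Sum>(\<tau>, J)\<in>B. g (Sup J) (Inf J))"
      proof (intro sum.cong refl)
        fix z
        assume "z \<in> B"
        then have "snd z \<in> D"
          by (auto simp: D_def)
        from nontrivial[OF this] show "(case z of (\<tau>, J) \<Rightarrow> if interior J = {} then 0 else g (Sup J) (Inf J)) =
            (case z of (\<tau>, J) \<Rightarrow> g (Sup J) (Inf J))"
          by (simp add: split_def)
      qed
      ultimately show ?thesis
        by simp
    qed
    have B_var: "(\<Sum>(\<tau>, J)\<in>B. \<bar>f (Sup J) - f (Inf J)\<bar>) < e"
      using sum_B[of "\<lambda>x y. \<bar>f x - f y\<bar>"] D_var by simp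
    have B_len: "(\<Sum>(\<tau>, J)\<in>B. Sup J - Inf J) < e"
      using sum_B[of "\<lambda>x y. x - y"] D_small by simp
    have "finite p"
      using pD by auto
    have split: "(\<Sum>z\<in>p. F z) = (\<Sum>z\<in>B. F z) + (\<Sum>z\<in>p - B. F z)" for F :: "real \<times> real set \<Rightarrow> real"
      using \<open>finite p\<close> by (metis (no_types) B_def Collect_subset sum.subset_diff add.commute)
    have good: "- (K + e) * (\<Sum>(\<tau>, J)\<in>p - B. Sup J - Inf J) \<le> (\<Sum>(\<tau>, J)\<in>p - B. f (Sup J) - f (Inf J))"
      unfolding sum_distrib_left
    proof (rule sum_mono, clarify)
      fix \<tau> J
      assume J: "(\<tau>, J) \<in> p" "(\<tau>, J) \<notin> B"
      show "- (K + e) * (Sup J - Inf J) \<le> f (Sup J) - f (Inf J)"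
        using ends[OF J(1)] J pD(2,3)[OF J(1)]
        by (intro r_good[of \<tau>]) (auto simp: B_def dist_real_def abs_minus_commute)
    qed
    define L where "L = (\<Sum>(\<tau>, J)\<in>B. Sup J - Inf J)"
    have "(\<Sum>(\<tau>, J)\<in>p. Sup J - Inf J) = b - a" "(\<Sum>(\<tau>, J)\<in>p. f (Sup J) - f (Inf J)) = f b - f a"
      using additive_tagged_division_1[OF \<open>a \<le> b\<close> p, of "\<lambda>x. x"]
        additive_tagged_division_1[OF \<open>a \<le> b\<close> p, of f] by auto
    then have pB_len: "(\<Sum>(\<tau>, J)\<in>p - B. Sup J - Inf J) = b - a - L"
      and pB_incr: "(\<Sum>(\<tau>, J)\<in>p - B. f (Sup J) - f (Inf J)) =
        f b - f a - (\<Sum>(\<tau>, J)\<in>B. f (Sup J) - f (Inf J))"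
      using split[of "\<lambda>(\<tau>, J). Sup J - Inf J"] split[of "\<lambda>(\<tau>, J). f (Sup J) - f (Inf J)"]
      unfolding L_def by linarith+
    have "\<bar>\<Sum>(\<tau>, J)\<in>B. f (Sup J) - f (Inf J)\<bar> \<le> (\<Sum>(\<tau>, J)\<in>B. \<bar>f (Sup J) - f (Inf J)\<bar>)"
      using sum_abs[of "\<lambda>(\<tau>, J). f (Sup J) - f (Inf J)" B] by (simp add: split_def)
    then have ineq: "- (K + e) * (b - a - L) \<le> f b - f a + e"
      using good B_var unfolding pB_len pB_incr by linarith
    have L: "0 \<le> L" "L < e"
      unfolding L_def using ends B_len by (auto intro!: sum_nonneg simp: B_def) force
    have "\<bar>(K + e) * L\<bar> \<le> \<bar>K + e\<bar> * e"
      using L by (simp add: abs_mult mult_left_mono)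
    then show ?thesis
      using ineq by (simp add: algebra_simps)
  qed
  have "((\<lambda>e. f b - f a + e * (1 + \<bar>K + e\<bar> + (b - a))) \<longlongrightarrow> f b - f a + 0 * (1 + \<bar>K + 0\<bar> + (b - a))) (at_right 0)"
    by (intro tendsto_intros)
  moreover have "eventually (\<lambda>e. - K * (b - a) \<le> f b - f a + e * (1 + \<bar>K + e\<bar> + (b - a))) (at_right 0)"
    using * by (auto simp: eventually_at_right_less eventually_at_filter)
  ultimately show ?thesis
    using tendsto_lowerbound[of _ "f b - f a + 0 * (1 + \<bar>K + 0\<bar> + (b - a))"] by fastforce
qed

lemma ac_imp_continuous_on:
  assumes "absolutely_continuous_on_interval a b f"
  shows "continuous_on {a..b} f"
  unfolding continuous_on_iff
proof (intro ballI allI impI)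
  fix s e :: real
  assume s: "s \<in> {a..b}" and e: "0 < e"
  obtain d where "d > 0" and d: "\<And>\<D> S. \<lbrakk>\<D> division_of S; S \<subseteq> {a..b};
      (\<Sum>I\<in>\<D>. Sup I - Inf I) < d\<rbrakk> \<Longrightarrow> (\<Sum>I\<in>\<D>. norm (f (Sup I) - f (Inf I))) < e"
    using assms e unfolding absolutely_continuous_on_interval_def by meson
  have *: "norm (f y - f x) < e" if "a \<le> x" "x \<le> y" "y \<le> b" "y - x < d" for x y
    using d[of "{{x..y}}" "{x..y}"] division_of_self[of x y] that by auto
  show "\<exists>d>0. \<forall>t\<in>{a..b}. dist t s < d \<longrightarrow> dist (f t) (f s) < e"
  proof (intro exI[of _ d] conjI ballI impI)
    fix t
    assume "t \<in> {a..b}" "dist t s < d"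
    then show "dist (f t) (f s) < e"
      using *[of s t] *[of t s] s by (cases "s \<le> t") (auto simp: dist_norm norm_minus_commute)
  qed fact
qed

section \<open>Quadratic forms of operators\<close>

lemma inner_eq_Re_sum: "v \<bullet> w = Re (\<Sum>i\<in>UNIV. cnj (v $ i) * w $ i)" for v w :: "complex ^ 'n"
  by (simp add: inner_vec_def inner_complex_def)

lemma inner_adjoint_matrix: "(adjoint_matrix A *v v) \<bullet> w = v \<bullet> (A *v w)" for A :: "complex ^ 'n ^ 'm"
proof -
  have "(\<Sum>i\<in>UNIV. cnj (\<Sum>j\<in>UNIV. cnj (A $ j $ i) * v $ j) * w $ i) =
      (\<Sum>j\<in>UNIV. cnj (v $ j) * (\<Sum>i\<in>UNIV. A $ j $ i * w $ i))"
    unfolding cnj_sum sum_distrib_left sum_distrib_right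
    by (subst sum.swap) (simp add: mult_ac)
  then show ?thesis
    by (simp add: inner_eq_Re_sum matrix_vector_mult_def adjoint_matrix_def transpose_def)
qed

lemma adjoint_matrix_involution: "adjoint_matrix (adjoint_matrix A) = A"
  by (simp add: adjoint_matrix_def transpose_def vec_eq_iff)

lemma inner_matrix_mult: "v \<bullet> (A *v w) = (adjoint_matrix A *v v) \<bullet> w" for A :: "complex ^ 'n ^ 'm"
  by (rule inner_adjoint_matrix[symmetric])

lemma inner_scalar_mult: "v \<bullet> (c *s w) = (cnj c *s v) \<bullet> w" for v :: "complex ^ 'n"
  by (simp add: inner_eq_Re_sum mult_ac)

lemma bounded_bilinear_matrix_vector_mult:
  "bounded_bilinear ((*v) :: complex ^ 'n ^ 'm \<Rightarrow> complex ^ 'n \<Rightarrow> complex ^ 'm)"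
proof -
  have "bilinear ((*v) :: complex ^ 'n ^ 'm \<Rightarrow> complex ^ 'n \<Rightarrow> complex ^ 'm)"
    unfolding bilinear_def linear_iff
    by (auto simp: algebra_simps matrix_vector_mult_def vec_eq_iff sum.distrib scaleR_sum_right)
  then show ?thesis
    by (simp add: bilinear_conv_bounded_bilinear)
qed

interpretation mat_vec: bounded_bilinear "(*v) :: complex ^ 'n ^ 'm \<Rightarrow> complex ^ 'n \<Rightarrow> complex ^ 'm"
  by (rule bounded_bilinear_matrix_vector_mult)

lemma quadratic_form_le:
  obtains B where "0 < B" "\<And>(X :: complex ^ 'n ^ 'n) v w. \<bar>v \<bullet> (X *v w)\<bar> \<le> B * norm X * (norm v * norm w)"
proof -
  obtain B where "0 < B" and B: "\<And>(X :: complex ^ 'n ^ 'n) w. norm (X *v w) \<le> norm X * norm w * B"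
    using mat_vec.pos_bounded by blast
  have "\<bar>v \<bullet> (X *v w)\<bar> \<le> B * norm X * (norm v * norm w)" for X :: "complex ^ 'n ^ 'n" and v w
  proof -
    have "\<bar>v \<bullet> (X *v w)\<bar> \<le> norm v * norm (X *v w)"
      by (rule Cauchy_Schwarz_ineq2)
    also have "\<dots> \<le> norm v * (norm X * norm w * B)"
      using B by (simp add: mult_left_mono)
    finally show ?thesis
      by (simp add: mult_ac)
  qed
  with \<open>0 < B\<close> show ?thesis
    using that by blast
qed

text \<open>The inner product on \<open>complex ^ 'n\<close> is the real part of the Hermitian one, so for Hermitian \<open>X\<close> this
  is the least eigenvalue.\<close>

definition min_form :: "complex ^ 'n ^ 'n \<Rightarrow> real"
  where "min_form X = Inf ((\<lambda>v. v \<bullet> (X *v v)) ` sphere 0 1)"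

lemma min_form_attained:
  obtains v :: "complex ^ 'n" where "norm v = 1" "v \<bullet> (X *v v) = min_form X"
    "\<And>w. norm w = 1 \<Longrightarrow> min_form X \<le> w \<bullet> (X *v w)"
proof -
  have "compact (sphere (0 :: complex ^ 'n) 1)"
    by simp
  moreover have "sphere (0 :: complex ^ 'n) 1 \<noteq> {}"
    by simp
  moreover have "continuous_on (sphere 0 1) (\<lambda>v. v \<bullet> (X *v v))"
    by (intro continuous_intros mat_vec.continuous_on)
  ultimately obtain v where v: "v \<in> sphere 0 1"
      "\<And>w. w \<in> sphere 0 1 \<Longrightarrow> v \<bullet> (X *v v) \<le> w \<bullet> (X *v w)"
    using continuous_attains_inf[of "sphere (0 :: complex ^ 'n) 1" "\<lambda>v. v \<bullet> (X *v v)"] by auto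
  then have "min_form X = v \<bullet> (X *v v)"
    unfolding min_form_def by (intro cInf_eq_minimum) auto
  then show ?thesis
    using that[of v] v by auto
qed

lemma min_form_le: "min_form X * (norm v)\<^sup>2 \<le> v \<bullet> (X *v v)"
proof (cases "v = 0")
  case False
  define w where "w = v /\<^sub>R norm v"
  have "norm w = 1" "v = norm v *\<^sub>R w"
    using False by (auto simp: w_def)
  then have "min_form X \<le> w \<bullet> (X *v w)"
    using min_form_attained[of X] by metis
  moreover have "v \<bullet> (X *v v) = (norm v)\<^sup>2 * (w \<bullet> (X *v w))"
    by (subst (1 2) \<open>v = _\<close>) (simp add: mat_vec.scaleR_right power2_eq_square)
  ultimately show ?thesis
    by (metis mult.commute mult_right_mono zero_le_power2)
qed simp

lemma min_form_greatest:
  assumes "\<And>v. norm v = 1 \<Longrightarrow> c \<le> v \<bullet> (X *v v)"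
  shows "c \<le> min_form X"
  using min_form_attained[of X] assms by metis

text \<open>On each unit vector the two forms differ by at most \<open>B * norm (X - Y)\<close>,
  hence so do their minima. This carries absolute continuity from the state to its least eigenvalue
  and turns an error in the state into an error of the same order in
  \<open>min_form\<close>.\<close>

lemma min_form_lipschitz:
  obtains B where "0 < B" "\<And>X Y :: complex ^ 'n ^ 'n. \<bar>min_form X - min_form Y\<bar> \<le> B * norm (X - Y)"
proof -
  obtain B where "0 < B" and
    B: "\<And>(X :: complex ^ 'n ^ 'n) v w. \<bar>v \<bullet> (X *v w)\<bar> \<le> B * norm X * (norm v * norm w)"
    using quadratic_form_le by blast
  have *: "min_form Y - B * norm (X - Y) \<le> min_form X" for X Y :: "complex ^ 'n ^ 'n"
  proof (rule min_form_greatest)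
    fix v :: "complex ^ 'n"
    assume v: "norm v = 1"
    have "v \<bullet> (X *v v) = v \<bullet> (Y *v v) + v \<bullet> ((X - Y) *v v)"
      by (simp add: mat_vec.diff_left inner_diff_right)
    then show "min_form Y - B * norm (X - Y) \<le> v \<bullet> (X *v v)"
      using B[of v "X - Y" v] min_form_le[of Y v] v by simp
  qed
  have "\<bar>min_form X - min_form Y\<bar> \<le> B * norm (X - Y)" for X Y :: "complex ^ 'n ^ 'n"
    using *[of X Y] *[of Y X] by (simp add: abs_le_iff norm_minus_commute)
  with \<open>0 < B\<close> show ?thesis
    using that by blast
qed

section \<open>The master equation preserves positive definiteness\<close>

text \<open>The operator \<open>G\<^sup>\<dagger>\<close>, where \<open>G = -iH - 1/2 \<Sum> L\<^sub>k\<^sup>\<dagger> L\<^sub>k\<close> generates the evolution between jumps.\<close>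

definition no_jump_adjoint ::
  "two_qubit_op \<Rightarrow> nat \<Rightarrow> (nat \<Rightarrow> two_qubit_op) \<Rightarrow> complex ^ (2 \<times> 2) \<Rightarrow> complex ^ (2 \<times> 2)"
  where "no_jump_adjoint H n L v =
    \<i> *s (H *v v) - (1 / 2) *\<^sub>R (\<Sum>k<n. adjoint_matrix (L k) *v (L k *v v))"

lemma imaginary_unit_matrix_vector:
  "map_matrix ((*) (- \<i>)) A *v v = (- \<i>) *s (A *v v)" for A :: "complex ^ 'n ^ 'm"
  by (simp add: matrix_vector_mult_def vec_eq_iff sum_distrib_left mult_ac sum_negf)

text \<open>All operators are moved from \<open>X\<close> onto \<open>v\<close>. The commutator and
  the anticommutator part of the dissipator then combine into \<open>no_jump_adjoint\<close>, and
  the jump terms become values of the form of \<open>X\<close>, nonnegative once \<open>X\<close> is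
  positive. As \<open>X\<close> is arbitrary here, the two cross terms stay separate.\<close>

lemma inner_master_rhs:
  assumes H: "hermitian H"
  shows "v \<bullet> (master_rhs H n L X *v v) =
    no_jump_adjoint H n L v \<bullet> (X *v v) + v \<bullet> (X *v no_jump_adjoint H n L v) +
    (\<Sum>k<n. (adjoint_matrix (L k) *v v) \<bullet> (X *v (adjoint_matrix (L k) *v v)))"
proof -
  have H_adj: "adjoint_matrix H = H"
    using H by (simp add: hermitian_def)
  have commutator: "v \<bullet> (map_matrix ((*) (- \<i>)) (H ** X - X ** H) *v v) =
      (\<i> *s (H *v v)) \<bullet> (X *v v) + v \<bullet> (X *v (\<i> *s (H *v v)))"
  proof -
    have "v \<bullet> ((- \<i>) *s (H *v (X *v v))) = (\<i> *s (H *v v)) \<bullet> (X *v v)"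
      unfolding inner_scalar_mult inner_matrix_mult[of _ H] H_adj
      by (simp add: vector_scalar_commute)
    moreover have "v \<bullet> ((- \<i>) *s (X *v (H *v v))) = - (v \<bullet> (X *v (\<i> *s (H *v v))))"
      by (simp add: vector_scalar_commute inner_eq_Re_sum sum_negf)
    ultimately show ?thesis
      unfolding imaginary_unit_matrix_vector
      by (simp add: mat_vec.diff_left vector_ssub_ldistrib inner_diff_right
          flip: matrix_vector_mul_assoc)
  qed
  have jump: "v \<bullet> ((L k ** X ** adjoint_matrix (L k)
        - (1 / 2) *\<^sub>R (adjoint_matrix (L k) ** L k ** X)
        - (1 / 2) *\<^sub>R (X ** adjoint_matrix (L k) ** L k)) *v v) =
      (adjoint_matrix (L k) *v v) \<bullet> (X *v (adjoint_matrix (L k) *v v))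
      - (1 / 2) * ((adjoint_matrix (L k) *v (L k *v v)) \<bullet> (X *v v))
      - (1 / 2) * (v \<bullet> (X *v (adjoint_matrix (L k) *v (L k *v v))))" for k
    by (simp add: mat_vec.diff_left mat_vec.scaleR_left inner_diff_right
        inner_matrix_mult[of _ "L k"] inner_matrix_mult[of _ "adjoint_matrix (L k)"]
        adjoint_matrix_involution flip: matrix_vector_mul_assoc)
  show ?thesis
    unfolding master_rhs_def dissipator_def no_jump_adjoint_def mat_vec.add_left inner_add_right
      commutator mat_vec.sum_left inner_sum_right jump
    by (simp add: mat_vec.diff_right mat_vec.scaleR_right mat_vec.sum_right inner_diff_left
        inner_diff_right inner_sum_left inner_sum_right sum_subtractf sum_distrib_left)
qed

text \<open>Multiplication by the imaginary unit makes a Hermitian operator skew for the real inner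
  product, so only the dissipative part survives. Hence the rate at which positivity can decay is
  independent of the Hamiltonian, and so of the control.\<close>

lemma inner_no_jump_adjoint:
  assumes H: "hermitian H"
  shows "v \<bullet> no_jump_adjoint H n L v = - (1 / 2) * (\<Sum>k<n. (norm (L k *v v))\<^sup>2)"
proof -
  have "v \<bullet> (\<i> *s (H *v v)) = - ((\<i> *s (H *v v)) \<bullet> v)"
  proof -
    have "v \<bullet> (\<i> *s (H *v v)) = (adjoint_matrix H *v (cnj \<i> *s v)) \<bullet> v"
      by (simp only: inner_scalar_mult inner_matrix_mult)
    also have "\<dots> = - ((\<i> *s (H *v v)) \<bullet> v)"
      using H by (simp add: hermitian_def vector_scalar_commute mat_vec.minus_right)
    finally show ?thesis .
  qed
  then have "v \<bullet> (\<i> *s (H *v v)) = 0"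
    by (simp add: inner_commute)
  then show ?thesis
    by (simp add: no_jump_adjoint_def inner_diff_right inner_sum_right inner_matrix_mult
        adjoint_matrix_involution power2_norm_eq_inner)
qed

text \<open>Increments of \<open>f\<close> are compared directly with those of \<open>x\<close>, so
  the modulus for \<open>e / B\<close> serves \<open>f\<close>. Restriction to a subinterval is
  included because the increment inequality is later applied on a part of
  \<open>{0..T}\<close>.\<close>

lemma ac_lipschitz_compose:
  assumes ac: "absolutely_continuous_on_interval a b x" and sub: "{c..d} \<subseteq> {a..b}"
    and B: "0 < B" "\<And>s t. \<bar>f s - f t\<bar> \<le> B * norm (x s - x t)"
  shows "absolutely_continuous_on_interval c d (f :: real \<Rightarrow> real)"
  unfolding absolutely_continuous_on_interval_def
proof (intro allI impI)
  fix e :: real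
  assume "0 < e"
  then have "0 < e / B"
    using B by simp
  then obtain \<delta> where "\<delta> > 0" and \<delta>: "\<And>\<D> S. \<lbrakk>\<D> division_of S; S \<subseteq> {a..b};
      (\<Sum>I\<in>\<D>. Sup I - Inf I) < \<delta>\<rbrakk> \<Longrightarrow> (\<Sum>I\<in>\<D>. norm (x (Sup I) - x (Inf I))) < e / B"
    using ac unfolding absolutely_continuous_on_interval_def by meson
  show "\<exists>\<delta>>0. \<forall>\<D> S. \<D> division_of S \<longrightarrow> S \<subseteq> {c..d} \<longrightarrow> (\<Sum>I\<in>\<D>. Sup I - Inf I) < \<delta> \<longrightarrow>
      (\<Sum>I\<in>\<D>. norm (f (Sup I) - f (Inf I))) < e"
  proof (intro exI[of _ \<delta>] conjI allI impI)
    fix \<D> S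
    assume D: "\<D> division_of S" "S \<subseteq> {c..d}" "(\<Sum>I\<in>\<D>. Sup I - Inf I) < \<delta>"
    have "(\<Sum>I\<in>\<D>. norm (f (Sup I) - f (Inf I))) \<le> (\<Sum>I\<in>\<D>. B * norm (x (Sup I) - x (Inf I)))"
      using B by (intro sum_mono) simp
    also have "\<dots> = B * (\<Sum>I\<in>\<D>. norm (x (Sup I) - x (Inf I)))"
      by (simp add: sum_distrib_left)
    also have "\<dots> < B * (e / B)"
      using \<delta>[OF D(1) subset_trans[OF D(2) sub] D(3)] B by (intro mult_strict_left_mono)
    finally show "(\<Sum>I\<in>\<D>. norm (f (Sup I) - f (Inf I))) < e"
      using B by simp
  qed fact
qed

lemma linear_master_rhs: "linear (master_rhs H n L)"
proof (rule linearI)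
  have eqI: "X = Y" if "\<And>v. X *v v = Y *v v" for X Y :: two_qubit_op
    using that by (simp add: matrix_eq)
  show "master_rhs H n L (X + Y) = master_rhs H n L X + master_rhs H n L Y" for X Y
    by (rule eqI) (simp add: master_rhs_def dissipator_def imaginary_unit_matrix_vector mat_vec.sum_left
        mat_vec.add_left mat_vec.add_right mat_vec.diff_left mat_vec.diff_right mat_vec.scaleR_left mat_vec.minus_left
        vector_add_ldistrib vector_ssub_ldistrib sum.distrib sum_subtractf algebra_simps
        flip: matrix_vector_mul_assoc)
  show "master_rhs H n L (r *\<^sub>R X) = r *\<^sub>R master_rhs H n L X" for r X
    by (rule eqI) (simp add: master_rhs_def dissipator_def imaginary_unit_matrix_vector mat_vec.sum_left
        mat_vec.add_left mat_vec.diff_left mat_vec.scaleR_left mat_vec.scaleR_right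
        scaleR_sum_right scaleR_diff_right scaleR_add_right mult.commute vec_eq_iff
        flip: matrix_vector_mul_assoc)
qed

lemma linear_no_jump_adjoint: "linear (no_jump_adjoint H n L)"
proof (rule linearI)
  show "no_jump_adjoint H n L (v + w) = no_jump_adjoint H n L v + no_jump_adjoint H n L w" for v w
    by (simp add: no_jump_adjoint_def mat_vec.add_right sum.distrib vector_add_ldistrib
        scaleR_add_right)
  show "no_jump_adjoint H n L (r *\<^sub>R v) = r *\<^sub>R no_jump_adjoint H n L v" for r v
    by (simp add: no_jump_adjoint_def mat_vec.scaleR_right scaleR_diff_right scaleR_sum_right
        mult.commute vec_eq_iff)
qed

text \<open>The constant depends on the jump operators alone, so one rate serves all times and all
  control values.\<close>

lemma jump_rate_bound:
  fixes L :: "nat \<Rightarrow> complex ^ 'n ^ 'm"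
  obtains c where "0 \<le> c" "\<And>v. norm v = 1 \<Longrightarrow> (\<Sum>k<n. (norm (L k *v v))\<^sup>2) \<le> c"
proof -
  obtain B where B: "\<And>(X :: complex ^ 'n ^ 'm) w. norm (X *v w) \<le> norm X * norm w * B"
    using mat_vec.bounded by blast
  have "(\<Sum>k<n. (norm (L k *v v))\<^sup>2) \<le> (\<Sum>k<n. (norm (L k) * B)\<^sup>2)" if "norm v = 1" for v
    using B[of "L _" v] that by (intro sum_mono power_mono) auto
  then show ?thesis
    by (intro that[of "\<Sum>k<n. (norm (L k) * B)\<^sup>2"]) (auto intro: sum_nonneg)
qed

text \<open>Up to an error of order \<open>h\<^sup>2\<close>, the Euler step is the completely positive map
  \<open>X \<mapsto> V X V\<^sup>\<dagger> + h \<Sum>\<^sub>k L\<^sub>k X L\<^sub>k\<^sup>\<dagger>\<close> with \<open>V = 1 + h G\<close>. The rate \<open>c\<close>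
  does not depend on \<open>H\<close>, which only contributes a rotation.\<close>

lemma min_form_euler_step:
  assumes H: "hermitian H" and c: "\<And>v. norm v = 1 \<Longrightarrow> (\<Sum>k<n. (norm (L k *v v))\<^sup>2) \<le> c"
  obtains C where "0 < C" "\<And>X h. \<lbrakk>0 \<le> min_form X; 0 \<le> h\<rbrakk> \<Longrightarrow>
    min_form X * (1 - c * h) - C * norm X * h\<^sup>2 \<le> min_form (X + h *\<^sub>R master_rhs H n L X)"
proof -
  obtain B where "0 < B" and
    B: "\<And>(X :: two_qubit_op) v w. \<bar>v \<bullet> (X *v w)\<bar> \<le> B * norm X * (norm v * norm w)"
    using quadratic_form_le by blast
  obtain G where "0 < G" and G: "\<And>v. norm (no_jump_adjoint H n L v) \<le> G * norm v"
    using linear_bounded_pos[OF linear_no_jump_adjoint] by blast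
  have "min_form X * (1 - c * h) - B * G\<^sup>2 * norm X * h\<^sup>2 \<le> min_form (X + h *\<^sub>R master_rhs H n L X)"
    if a: "0 \<le> min_form X" and h: "0 \<le> h" for X h
  proof (rule min_form_greatest)
    fix v :: "complex ^ (2 \<times> 2)"
    assume v: "norm v = 1"
    define g where "g = no_jump_adjoint H n L v"
    have jumps: "0 \<le> (\<Sum>k<n. (adjoint_matrix (L k) *v v) \<bullet> (X *v (adjoint_matrix (L k) *v v)))"
      using a min_form_le[of X] by (intro sum_nonneg) (meson mult_nonneg_nonneg order_trans zero_le_power2)
    have "norm g * norm g \<le> G * G"
      using G[of v] v \<open>0 < G\<close> by (intro mult_mono) (auto simp: g_def)
    then have "B * norm X * (norm g * norm g) \<le> B * norm X * (G * G)"
      using \<open>0 < B\<close> by (intro mult_left_mono) auto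
    then have "g \<bullet> (X *v g) \<le> B * norm X * (G * G)"
      using B[of g X g] by linarith
    then have "h\<^sup>2 * (g \<bullet> (X *v g)) \<le> h\<^sup>2 * (B * norm X * (G * G))"
      by (intro mult_left_mono) auto
    then have quad: "h\<^sup>2 * (g \<bullet> (X *v g)) \<le> B * G\<^sup>2 * norm X * h\<^sup>2"
      by (simp add: power2_eq_square mult_ac)
    \<comment> \<open>Lower bound for the squared length of \<open>v + h *\<^sub>R g\<close>, the
      vector to which the adjoint of \<open>V\<close> sends \<open>v\<close>: its first-order term
      is at least \<open>- c * h\<close>, and the nonnegative term of order two is dropped.\<close>
    have "v \<bullet> g \<ge> - (1 / 2) * c"
      using inner_no_jump_adjoint[OF H, of v n L] c[OF v] by (simp add: g_def)
    then have "h * c + 2 * (h * (v \<bullet> g)) \<ge> 0"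
      using h mult_left_mono[of "- (1 / 2) * c" "v \<bullet> g" h] by simp
    moreover have "(norm (v + h *\<^sub>R g))\<^sup>2 = 1 + 2 * (h * (v \<bullet> g)) + h\<^sup>2 * (norm g)\<^sup>2"
      using v unfolding power2_norm_eq_inner norm_eq_1
      by (simp add: inner_add_left inner_add_right inner_commute power2_eq_square algebra_simps)
    ultimately have "1 - c * h \<le> (norm (v + h *\<^sub>R g))\<^sup>2"
      by (smt (verit) mult.commute mult_nonneg_nonneg zero_le_power2)
    then have "min_form X * (1 - c * h) \<le> min_form X * (norm (v + h *\<^sub>R g))\<^sup>2"
      using a by (intro mult_left_mono)
    \<comment> \<open>Expanding this form reproduces the Euler step without its jump terms, plus the
      \<open>h\<^sup>2\<close> term bounded in \<open>quad\<close>. The jump terms are nonnegative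
      and are added afterwards.\<close>
    also have "\<dots> \<le> (v + h *\<^sub>R g) \<bullet> (X *v (v + h *\<^sub>R g))"
      by (rule min_form_le)
    also have "\<dots> = v \<bullet> (X *v v) + h * (g \<bullet> (X *v v) + v \<bullet> (X *v g)) + h\<^sup>2 * (g \<bullet> (X *v g))"
      by (simp add: mat_vec.add_right mat_vec.scaleR_right inner_add_left inner_add_right
          power2_eq_square algebra_simps)
    finally have "min_form X * (1 - c * h) - B * G\<^sup>2 * norm X * h\<^sup>2
        \<le> v \<bullet> (X *v v) + h * (g \<bullet> (X *v v) + v \<bullet> (X *v g))"
      using quad by linarith
    also have "\<dots> \<le> v \<bullet> (X *v v) + h * (v \<bullet> (master_rhs H n L X *v v))"
      unfolding inner_master_rhs[OF H] g_def[symmetric]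
      using h jumps by (intro add_left_mono mult_left_mono) auto
    also have "\<dots> = v \<bullet> ((X + h *\<^sub>R master_rhs H n L X) *v v)"
      by (simp add: mat_vec.add_left mat_vec.scaleR_left inner_add_right)
    finally show "min_form X * (1 - c * h) - B * G\<^sup>2 * norm X * h\<^sup>2
        \<le> v \<bullet> ((X + h *\<^sub>R master_rhs H n L X) *v v)" .
  qed
  moreover have "0 < B * G\<^sup>2"
    using \<open>0 < B\<close> \<open>0 < G\<close> by simp
  ultimately show ?thesis
    using that by blast
qed

text \<open>Differentiability at \<tau> makes \<open>x t\<close> an Euler step from
  \<open>x s\<close> up to a small multiple of \<open>t - s\<close>, whenever \<tau> lies between
  \<open>s\<close> and \<open>t\<close>. The Euler estimate then bounds the loss of
  \<open>min_form\<close>. The upper bound \<open>M\<close> replaces the state-dependent rate by a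
  constant, as \<open>ac_increment_ge\<close> demands.\<close>

lemma min_form_increment_ge:
  fixes x :: "real \<Rightarrow> two_qubit_op"
  assumes H: "hermitian H" and c: "0 \<le> c" "\<And>v. norm v = 1 \<Longrightarrow> (\<Sum>k<n. (norm (L k *v v))\<^sup>2) \<le> c"
    and deriv: "(x has_vector_derivative master_rhs H n L (x \<tau>)) (at \<tau> within S)" and "\<tau> \<in> S" "0 < e"
  shows "\<exists>d>0. \<forall>s\<in>S. \<forall>t\<in>S. s \<le> \<tau> \<longrightarrow> \<tau> \<le> t \<longrightarrow> \<bar>s - \<tau>\<bar> < d \<longrightarrow> \<bar>t - \<tau>\<bar> < d \<longrightarrow>
    0 \<le> min_form (x s) \<longrightarrow> min_form (x s) \<le> M \<longrightarrow>
    - (c * M + e) * (t - s) \<le> min_form (x t) - min_form (x s)"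
proof -
  define A where "A = master_rhs H n L"
  obtain C where "0 < C" and C: "\<And>X h. \<lbrakk>0 \<le> min_form X; 0 \<le> h\<rbrakk> \<Longrightarrow>
      min_form X * (1 - c * h) - C * norm X * h\<^sup>2 \<le> min_form (X + h *\<^sub>R A X)"
    using min_form_euler_step[OF H c(2)] unfolding A_def by blast
  obtain B where "0 < B" and B: "\<And>X Y :: two_qubit_op. \<bar>min_form X - min_form Y\<bar> \<le> B * norm (X - Y)"
    using min_form_lipschitz by blast
  \<comment> \<open>The state will deviate from the Euler step by at most \<open>2 * e' * h\<close>,
    which after the Lipschitz factor \<open>B\<close> is half of the allowed error
    \<open>e * h\<close>.\<close>
  define e' where "e' = e / (4 * B)"
  have "0 < e'"
    using \<open>0 < e\<close> \<open>0 < B\<close> by (simp add: e'_def)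
  obtain d1 where "0 < d1" and
    d1: "\<And>t. \<lbrakk>t \<in> S; \<bar>t - \<tau>\<bar> < d1\<rbrakk> \<Longrightarrow> norm (x t - x \<tau> - (t - \<tau>) *\<^sub>R A (x \<tau>)) \<le> e' * \<bar>t - \<tau>\<bar>"
    using deriv \<open>0 < e'\<close>
    unfolding has_vector_derivative_def has_derivative_within_alt A_def real_norm_def by blast
  have cont: "continuous (at \<tau> within S) x"
    using deriv has_vector_derivative_continuous by blast
  then obtain d2 where "0 < d2" and d2: "\<And>t. \<lbrakk>t \<in> S; \<bar>t - \<tau>\<bar> < d2\<rbrakk> \<Longrightarrow> dist (x t) (x \<tau>) < 1"
    unfolding continuous_within_eps_delta dist_real_def by (meson zero_less_one)
  have "bounded_linear A"
    using linear_master_rhs by (simp add: A_def linear_conv_bounded_linear)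
  then have "continuous (at \<tau> within S) (\<lambda>t. A (x t))"
    using cont by (rule bounded_linear.continuous)
  then obtain d3 where "0 < d3" and d3: "\<And>t. \<lbrakk>t \<in> S; \<bar>t - \<tau>\<bar> < d3\<rbrakk> \<Longrightarrow> dist (A (x t)) (A (x \<tau>)) < e'"
    unfolding continuous_within_eps_delta dist_real_def using \<open>0 < e'\<close> by meson
  \<comment> \<open>The other half of the error: since \<open>h \<le> 2 * d4\<close>, this choice
    makes the quadratic Euler error at most \<open>e / 2 * h\<close>. The summand \<open>1\<close>
    comes from the neighbourhood \<open>d2\<close>, where \<open>norm (x s)\<close> exceeds
    \<open>norm (x \<tau>)\<close> by at most one.\<close>
  define d4 where "d4 = e / (4 * C * (norm (x \<tau>) + 1))"
  have "0 < norm (x \<tau>) + 1"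
    by (simp add: add_nonneg_pos)
  then have "0 < d4"
    using \<open>0 < e\<close> \<open>0 < C\<close> by (simp add: d4_def)
  show ?thesis
  proof (intro exI[of _ "min (min d1 d2) (min d3 d4)"] conjI ballI impI)
    fix s t
    assume st: "s \<in> S" "t \<in> S" "s \<le> \<tau>" "\<tau> \<le> t"
      and "\<bar>s - \<tau>\<bar> < min (min d1 d2) (min d3 d4)" "\<bar>t - \<tau>\<bar> < min (min d1 d2) (min d3 d4)"
      and m: "0 \<le> min_form (x s)" "min_form (x s) \<le> M"
    then have near: "\<bar>s - \<tau>\<bar> < d1" "\<bar>t - \<tau>\<bar> < d1" "\<bar>s - \<tau>\<bar> < d2" "\<bar>s - \<tau>\<bar> < d3" "\<bar>s - \<tau>\<bar> < d4" "\<bar>t - \<tau>\<bar> < d4"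
      by auto
    define h where "h = t - s"
    have h: "0 \<le> h" "h \<le> 2 * d4"
      using st near by (auto simp: h_def)
    \<comment> \<open>Two first-order remainders at \<tau>, and the change of the vector field
      between \<tau> and \<open>s\<close>.\<close>
    have "x t - (x s + h *\<^sub>R A (x s)) = (x t - x \<tau> - (t - \<tau>) *\<^sub>R A (x \<tau>))
        - (x s - x \<tau> - (s - \<tau>) *\<^sub>R A (x \<tau>)) - h *\<^sub>R (A (x s) - A (x \<tau>))"
      by (simp add: h_def algebra_simps)
    also have "norm \<dots> \<le> norm (x t - x \<tau> - (t - \<tau>) *\<^sub>R A (x \<tau>))
        + norm (x s - x \<tau> - (s - \<tau>) *\<^sub>R A (x \<tau>)) + norm (h *\<^sub>R (A (x s) - A (x \<tau>)))"
      by (meson norm_triangle_ineq4 order_trans add_right_mono)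
    also have "\<dots> \<le> e' * (t - \<tau>) + e' * (\<tau> - s) + h * e'"
      using d1[of t] d1[of s] d3[of s] st near h
      by (intro add_mono) (auto simp: dist_norm intro: mult_left_mono)
    also have "\<dots> = 2 * e' * h"
      by (simp add: h_def algebra_simps)
    finally have "B * norm (x t - (x s + h *\<^sub>R A (x s))) \<le> B * (2 * e' * h)"
      using \<open>0 < B\<close> by (intro mult_left_mono) auto
    also have "\<dots> = e / 2 * h"
      using \<open>0 < B\<close> by (simp add: e'_def)
    finally have straddle: "min_form (x s + h *\<^sub>R A (x s)) - e / 2 * h \<le> min_form (x t)"
      using B[of "x t" "x s + h *\<^sub>R A (x s)"] by linarith
    have "norm (x s) \<le> norm (x \<tau>) + 1"
      using d2[OF st(1) near(3)] norm_triangle_ineq2[of "x s" "x \<tau>"] by (simp add: dist_norm)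
    then have "C * norm (x s) * h \<le> C * (norm (x \<tau>) + 1) * (2 * d4)"
      using h \<open>0 < C\<close> by (intro mult_mono) auto
    also have "\<dots> = e / 2"
      using \<open>0 < C\<close> \<open>0 < norm (x \<tau>) + 1\<close> by (simp add: d4_def)
    finally have "C * norm (x s) * h * h \<le> e / 2 * h"
      using h by (intro mult_right_mono)
    then have "C * norm (x s) * h\<^sup>2 \<le> e / 2 * h"
      by (simp add: power2_eq_square mult.assoc)
    moreover have "min_form (x s) * (c * h) \<le> M * (c * h)"
      using m c h by (intro mult_right_mono) auto
    moreover have "min_form (x s) - min_form (x s) * (c * h) - C * norm (x s) * h\<^sup>2 \<le> min_form (x s + h *\<^sub>R A (x s))"
      using C[OF m(1) h(1)] by (simp add: algebra_simps)
    moreover have "- (c * M + e) * h = - (M * (c * h)) - e / 2 * h - e / 2 * h"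
      by (simp add: algebra_simps)
    ultimately show "- (c * M + e) * (t - s) \<le> min_form (x t) - min_form (x s)"
      using straddle unfolding h_def[symmetric] by linarith
  qed (use \<open>0 < d1\<close> \<open>0 < d2\<close> \<open>0 < d3\<close> \<open>0 < d4\<close> in auto)
qed

text \<open>A substitute for Gronwall's inequality. On a short window ending at the first zero
  \<open>b\<close>, start from a maximum point \<open>s\<close> of \<open>m\<close>. The loss up to
  \<open>b\<close> is at most \<open>c * m s * (b - s)\<close>, which is less than
  \<open>m s\<close>, so \<open>m\<close> cannot vanish at \<open>b\<close>.\<close>

lemma min_form_pos_preserved:
  assumes "0 \<le> T" and H: "\<And>t. hermitian (H t)"
    and sol: "caratheodory_solution T (\<lambda>t. master_rhs (H t) n L) x"
    and pos: "0 < min_form (x 0)"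
  shows "0 < min_form (x T)"
proof (rule ccontr)
  assume "\<not> 0 < min_form (x T)"
  have ac: "absolutely_continuous_on_interval 0 T x"
    and AE: "AE t in lebesgue_on {0..T}.
      (x has_vector_derivative master_rhs (H t) n L (x t)) (at t within {0..T})"
    using sol by (auto simp: caratheodory_solution_def)
  obtain c where c: "0 \<le> c" "\<And>v. norm v = 1 \<Longrightarrow> (\<Sum>k<n. (norm (L k *v v))\<^sup>2) \<le> c"
    using jump_rate_bound[of L n] by blast
  obtain B where B: "0 < B" "\<And>X Y :: two_qubit_op. \<bar>min_form X - min_form Y\<bar> \<le> B * norm (X - Y)"
    using min_form_lipschitz by blast
  define m where "m t = min_form (x t)" for t
  have ac_m: "absolutely_continuous_on_interval a b m" if "{a..b} \<subseteq> {0..T}" for a b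
    using ac_lipschitz_compose[OF ac that B(1), of m] B(2) by (simp add: m_def)
  then have cont: "continuous_on {a..b} m" if "{a..b} \<subseteq> {0..T}" for a b
    using that ac_imp_continuous_on by blast
  have zero: "\<exists>t\<ge>0. t \<le> s \<and> m t = 0" if "0 \<le> s" "s \<le> T" "m s \<le> 0" for s
    using IVT2'[of m s 0 0] that pos cont[of 0 s] by (auto simp: m_def)
  define Z where "Z = {0..T} \<inter> m -` {0}"
  have "closed Z"
    unfolding Z_def using cont[of 0 T] by (intro continuous_closed_preimage) auto
  moreover have "Z \<noteq> {}"
    using zero[of T] \<open>0 \<le> T\<close> \<open>\<not> 0 < min_form (x T)\<close> by (auto simp: Z_def m_def)
  moreover have "bdd_below Z"
    by (auto simp: Z_def)
  ultimately have "Inf Z \<in> Z" and Z_least: "\<And>t. t \<in> Z \<Longrightarrow> Inf Z \<le> t"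
    using closed_contains_Inf cInf_lower by blast+
  define b where "b = Inf Z"
  have b: "0 \<le> b" "b \<le> T" "m b = 0"
    using \<open>Inf Z \<in> Z\<close> by (auto simp: Z_def b_def)
  with pos have "0 < b"
    by (cases "b = 0") (auto simp: m_def)
  have m_pos: "0 < m t" if t: "0 \<le> t" "t < b" for t
  proof (rule ccontr)
    assume "\<not> 0 < m t"
    then obtain t' where "0 \<le> t'" "t' \<le> t" "m t' = 0"
      using zero[of t] t b by auto
    then have "b \<le> t'"
      using Z_least[of t'] that b by (auto simp: Z_def b_def)
    with that \<open>t' \<le> t\<close> show False
      by simp
  qed
  \<comment> \<open>A window with \<open>c * (b - a) < 1\<close>; the summand \<open>1\<close> keeps
    the denominator positive when \<open>c = 0\<close>.\<close>
  define a where "a = max 0 (b - 1 / (2 * c + 1))"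
  have a: "0 \<le> a" "a < b" "c * (b - a) < 1"
  proof -
    show "0 \<le> a" "a < b"
      using \<open>0 < b\<close> c by (auto simp: a_def)
    have "b - a \<le> 1 / (2 * c + 1)"
      by (simp add: a_def)
    then have "c * (b - a) \<le> c * (1 / (2 * c + 1))"
      using c by (intro mult_left_mono)
    also have "\<dots> < 1"
      using c by (simp add: divide_simps)
    finally show "c * (b - a) < 1" .
  qed
  \<comment> \<open>Maximality makes \<open>m s\<close> a valid bound \<open>M\<close> in
    \<open>min_form_increment_ge\<close> on all of \<open>{s..b}\<close>.\<close>
  obtain s where s: "a \<le> s" "s \<le> b" and s_max: "\<And>t. t \<in> {a..b} \<Longrightarrow> m t \<le> m s"
    using continuous_attains_sup[of "{a..b}" m] cont[of a b] a b by auto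
  have "0 < m s"
    using m_pos[of a] s_max[of a] a by auto
  define N where "N = {t \<in> {0..T}. \<not> (x has_vector_derivative master_rhs (H t) n L (x t)) (at t within {0..T})}"
  have "AE t in lebesgue. t \<notin> N"
    using AE by (simp add: AE_restrict_space_iff N_def) (auto elim: eventually_mono)
  then have "negligible N"
    by (simp add: negligible_iff_null_sets completion.null_sets_iff_AE)
  have "- (c * m s) * (b - s) \<le> m b - m s"
  proof (rule ac_increment_ge[OF s(2) ac_m \<open>negligible N\<close>])
    show "{s..b} \<subseteq> {0..T}"
      using s a b by auto
    fix \<tau> e :: real
    assume \<tau>: "\<tau> \<in> {s..b} - N" and "0 < e"
    then have "\<tau> \<in> {0..T}"
      using s a b by auto
    with \<tau> have "(x has_vector_derivative master_rhs (H \<tau>) n L (x \<tau>)) (at \<tau> within {0..T})"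
      by (auto simp: N_def)
    from min_form_increment_ge[OF H c this \<open>\<tau> \<in> {0..T}\<close> \<open>0 < e\<close>, of "m s"]
    obtain d where "0 < d" and d: "\<And>r t. \<lbrakk>r \<in> {0..T}; t \<in> {0..T}; r \<le> \<tau>; \<tau> \<le> t; \<bar>r - \<tau>\<bar> < d; \<bar>t - \<tau>\<bar> < d;
        0 \<le> m r; m r \<le> m s\<rbrakk> \<Longrightarrow> - (c * m s + e) * (t - r) \<le> m t - m r"
      unfolding m_def by meson
    have "- (c * m s + e) * (t - r) \<le> m t - m r"
      if "s \<le> r" "r \<le> \<tau>" "\<tau> \<le> t" "t \<le> b" "\<bar>r - \<tau>\<bar> < d" "\<bar>t - \<tau>\<bar> < d" for r t
    proof -
      have "0 \<le> m r"
        using m_pos[of r] b a s that by (cases "r = b") auto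
      then show ?thesis
        using that a b s s_max[of r] by (intro d) auto
    qed
    with \<open>0 < d\<close> show "\<exists>d>0. \<forall>r t. s \<le> r \<longrightarrow> r \<le> \<tau> \<longrightarrow> \<tau> \<le> t \<longrightarrow> t \<le> b \<longrightarrow> \<bar>r - \<tau>\<bar> < d \<longrightarrow> \<bar>t - \<tau>\<bar> < d \<longrightarrow>
        - (c * m s + e) * (t - r) \<le> m t - m r"
      by blast
  qed
  then have "m s \<le> m s * (c * (b - s))"
    using b by (simp add: algebra_simps)
  moreover have "c * (b - s) < 1"
    using a s c mult_left_mono[of "b - s" "b - a" c] by linarith
  ultimately show False
    using \<open>0 < m s\<close> by simp
qed

section \<open>Interior states and states with pure partial trace\<close>

lemma hermitian_add: "hermitian A \<Longrightarrow> hermitian B \<Longrightarrow> hermitian (A + B)"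
  by (simp add: hermitian_def adjoint_matrix_def transpose_def vec_eq_iff)

lemma hermitian_scaleR: "hermitian A \<Longrightarrow> hermitian (r *\<^sub>R A)"
  by (simp add: hermitian_def adjoint_matrix_def transpose_def vec_eq_iff)

lemma hermitian_mat: "hermitian (mat (of_real r))"
  by (auto simp: hermitian_def adjoint_matrix_def transpose_def vec_eq_iff mat_def)

lemma hermitian_tensor_op: "hermitian A \<Longrightarrow> hermitian B \<Longrightarrow> hermitian (tensor_op A B)"
  by (simp add: hermitian_def adjoint_matrix_def transpose_def vec_eq_iff tensor_op_def)

lemma hermitian_entry:
  assumes "hermitian A"
  shows "A $ j $ i = cnj (A $ i $ j)"
proof -
  have "A $ j $ i = adjoint_matrix A $ j $ i"
    using assms by (simp only: hermitian_def)
  also have "\<dots> = cnj (A $ i $ j)"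
    by (simp add: adjoint_matrix_def transpose_def)
  finally show ?thesis .
qed

text \<open>Hermitian matrices form a real subspace, which neither the real span containing
  \<open>HI\<close> nor the real control coefficients leave.\<close>

lemma hermitian_hamiltonian:
  assumes "hA0 \<in> traceless_hermitian" "\<And>j. hA j \<in> traceless_hermitian"
    "hB \<in> traceless_hermitian" "HI \<in> traceless_hermitian_tensor"
  shows "hermitian (hamiltonian hA0 hA HI hB u)"
proof -
  have subspace: "subspace {A :: complex ^ 'n ^ 'n. hermitian A}"
    using hermitian_mat[of 0, where 'a='n]
    by (auto simp: subspace_def hermitian_add hermitian_scaleR)
  have "hermitian (hA0 + (\<Sum>j\<in>UNIV. (u $ j) *\<^sub>R hA j))"
    using assms subspace_sum[OF subspace, of UNIV "\<lambda>j. (u $ j) *\<^sub>R hA j"]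
    by (auto simp: traceless_hermitian_def intro: hermitian_add hermitian_scaleR)
  moreover have "traceless_hermitian_tensor \<subseteq> {A. hermitian A}"
    unfolding traceless_hermitian_tensor_def using subspace
    by (intro span_minimal) (auto simp: traceless_hermitian_def hermitian_tensor_op)
  ultimately show ?thesis
    using assms hermitian_mat[of 1, where 'a=2]
    by (auto simp: hamiltonian_def traceless_hermitian_def intro!: hermitian_add hermitian_tensor_op)
qed

lemma trace_scaleR: "trace (r *\<^sub>R A) = r *\<^sub>R trace (A :: complex ^ 'n ^ 'n)"
  by (simp add: trace_def scaleR_sum_right)

lemma linear_Re_trace_mult: "linear (\<lambda>X. Re (trace (A ** X)))" for A :: "complex ^ 'n ^ 'n"
  by (rule linearI) (simp_all add: matrix_add_ldistrib trace_add matrix_scalar_ac trace_scaleR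
      flip: scalar_matrix_assoc)

lemma matrix_add_rdistrib: "(A + B) ** C = A ** C + B ** (C :: 'a :: semiring_1 ^ 'n ^ 'm)"
  by (simp add: matrix_matrix_mult_def vec_eq_iff distrib_right sum.distrib)

text \<open>For Hermitian \<open>A\<close> this trace is the squared Hilbert-Schmidt norm.\<close>

lemma Re_trace_hermitian_square_eq_0:
  assumes "hermitian A" "Re (trace (A ** A)) = 0"
  shows "A = 0"
proof -
  have "Re (A $ i $ j * A $ j $ i) = (cmod (A $ i $ j))\<^sup>2" for i j
  proof -
    have "A $ j $ i = cnj (A $ i $ j)"
      using hermitian_entry assms(1) .
    then show ?thesis
      by (simp add: cmod_power2 flip: power2_eq_square)
  qed
  then have "Re (trace (A ** A)) = (\<Sum>i\<in>UNIV. \<Sum>j\<in>UNIV. (cmod (A $ i $ j))\<^sup>2)"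
    by (simp only: trace_def matrix_matrix_mult_def vec_lambda_beta Re_sum)
  then show ?thesis
    using assms(2) by (simp add: sum_nonneg_eq_0_iff sum_nonneg vec_eq_iff)
qed

text \<open>\<open>A\<close> is orthogonal to a spanning family, hence to itself. This is how a
  state is recovered from its coherence coordinates.\<close>

lemma traceless_hermitian_eq_0:
  assumes basis: "orthonormal_basis_traceless_hermitian \<Lambda>" and A: "A \<in> traceless_hermitian"
    and zero: "\<And>j. Re (trace (A ** \<Lambda> j)) = 0"
  shows "A = 0"
proof -
  have "A \<in> span (range \<Lambda>)"
    using basis A by (simp add: orthonormal_basis_traceless_hermitian_def)
  then have "Re (trace (A ** A)) = 0"
    by (rule linear_eq_0_on_span[OF linear_Re_trace_mult, rotated]) (use zero in auto)
  then show ?thesis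
    using A Re_trace_hermitian_square_eq_0 by (auto simp: traceless_hermitian_def)
qed

lemma density_matrix_hermitian: "\<rho> \<in> density_matrices \<Longrightarrow> hermitian \<rho>"
  by (simp add: density_matrices_def positive_semidefinite_def)

lemma density_matrix_form_nonneg: "\<rho> \<in> density_matrices \<Longrightarrow> 0 \<le> v \<bullet> (\<rho> *v v)"
  unfolding density_matrices_def positive_semidefinite_def inner_eq_Re_sum by blast

text \<open>An interior state can be moved slightly away from the maximally mixed one without leaving
  the set of states, so it has a positive portion of the latter.\<close>

lemma min_form_pos_of_interior:
  assumes basis: "orthonormal_basis_traceless_hermitian \<Lambda>" and \<rho>: "\<rho> \<in> density_matrices"
    and int: "coherence_vector \<Lambda> \<rho> \<in>
      top_of_set coherence_hyperplane interior_of (coherence_vector \<Lambda> ` density_matrices)"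
  shows "0 < min_form \<rho>"
proof -
  obtain U where "openin (top_of_set coherence_hyperplane) U" "coherence_vector \<Lambda> \<rho> \<in> U"
    and U: "U \<subseteq> coherence_vector \<Lambda> ` density_matrices"
    using int by (auto simp: interior_of_def)
  then obtain \<epsilon> where "0 < \<epsilon>" and \<epsilon>: "\<And>y. \<lbrakk>y \<in> coherence_hyperplane; dist y (coherence_vector \<Lambda> \<rho>) < \<epsilon>\<rbrakk> \<Longrightarrow> y \<in> U"
    unfolding openin_euclidean_subtopology_iff by metis
  define r where "r = snd (coherence_vector \<Lambda> \<rho>)"
  \<comment> \<open>Scaling \<open>r\<close> by \<open>1 + s\<close> moves it by
    \<open>s * norm r\<close>, less than \<epsilon>; adding \<open>1\<close> covers
    \<open>r = 0\<close>, the maximally mixed state.\<close>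
  define s where "s = \<epsilon> / (norm r + 1)"
  have "0 < norm r + 1"
    by (simp add: add_nonneg_pos)
  then have "0 < s" and "s * norm r < \<epsilon>"
    using \<open>0 < \<epsilon>\<close> by (auto simp: s_def divide_simps)
  have "dist (1 / 2, (1 + s) *\<^sub>R r) (coherence_vector \<Lambda> \<rho>) < \<epsilon>"
    using \<open>s * norm r < \<epsilon>\<close> \<open>0 < s\<close>
    by (simp add: coherence_vector_def r_def dist_Pair_Pair dist_norm scaleR_add_left)
  then have "(1 / 2, (1 + s) *\<^sub>R r) \<in> coherence_vector \<Lambda> ` density_matrices"
    using \<epsilon> U by (auto simp: coherence_hyperplane_def)
  then obtain \<sigma> where \<sigma>: "\<sigma> \<in> density_matrices" and "(1 / 2, (1 + s) *\<^sub>R r) = coherence_vector \<Lambda> \<sigma>"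
    by auto
  then have coh: "Re (trace (\<sigma> ** \<Lambda> j)) = (1 + s) * Re (trace (\<rho> ** \<Lambda> j))" for j
    by (auto simp: coherence_vector_def r_def vec_eq_iff)
  \<comment> \<open>The difference between \<sigma> and the matrix that should have its coordinates.
    The coefficient \<open>s / 4\<close> makes the trace vanish, the identity having trace
    4.\<close>
  define D where "D = \<sigma> + ((- (1 + s)) *\<^sub>R \<rho> + (s / 4) *\<^sub>R mat 1)"
  have trace_mat: "trace (mat 1 :: two_qubit_op) = 4"
    by (simp add: trace_def mat_def)
  have "hermitian D"
    unfolding D_def using \<sigma> \<rho> hermitian_mat[of 1, where 'a="2 \<times> 2"]
    by (intro hermitian_add hermitian_scaleR) (auto intro: density_matrix_hermitian)
  moreover have "trace D = 0"
    unfolding D_def trace_add trace_scaleR trace_mat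
    using \<sigma> \<rho> by (simp add: density_matrices_def complex_eq_iff)
  ultimately have "D \<in> traceless_hermitian"
    by (simp add: traceless_hermitian_def)
  moreover have "Re (trace (D ** \<Lambda> j)) = 0" for j
  proof -
    have "\<Lambda> j \<in> traceless_hermitian"
      using basis span_base[of "\<Lambda> j" "range \<Lambda>"] by (simp add: orthonormal_basis_traceless_hermitian_def)
    then have "trace (\<Lambda> j) = 0"
      by (simp add: traceless_hermitian_def)
    moreover have "D ** \<Lambda> j = \<sigma> ** \<Lambda> j + ((- (1 + s)) *\<^sub>R (\<rho> ** \<Lambda> j) + (s / 4) *\<^sub>R \<Lambda> j)"
      by (simp add: D_def matrix_add_rdistrib scalar_matrix_assoc[symmetric])
    ultimately show ?thesis
      using coh[of j] by (simp only: trace_add trace_scaleR) (simp add: algebra_simps)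
  qed
  ultimately have "D = 0"
    using traceless_hermitian_eq_0[OF basis] by blast
  then have \<sigma>_eq: "\<sigma> = (1 + s) *\<^sub>R \<rho> - (s / 4) *\<^sub>R mat 1"
    by (simp add: D_def algebra_simps eq_neg_iff_add_eq_0)
  have "s / (4 * (1 + s)) \<le> v \<bullet> (\<rho> *v v)" if "norm v = 1" for v
  proof -
    have "0 \<le> v \<bullet> (\<sigma> *v v)"
      using density_matrix_form_nonneg \<sigma> .
    also have "\<dots> = (1 + s) * (v \<bullet> (\<rho> *v v)) - s / 4"
      using that by (simp add: \<sigma>_eq mat_vec.diff_left mat_vec.scaleR_left inner_diff_right
          norm_eq_1)
    finally show ?thesis
      using \<open>0 < s\<close> by (simp add: field_simps)
  qed
  then have "s / (4 * (1 + s)) \<le> min_form \<rho>"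
    by (rule min_form_greatest)
  then show ?thesis
    using \<open>0 < s\<close> by (smt (verit) divide_pos_pos)
qed

lemma UNIV_2_times_2: "(UNIV :: (2 \<times> 2) set) = {(1, 1), (1, 2), (2, 1), (2, 2)}"
  unfolding UNIV_Times_UNIV[symmetric] UNIV_2 by auto

definition tensor_vec :: "complex ^ 2 \<Rightarrow> complex ^ 2 \<Rightarrow> complex ^ (2 \<times> 2)"
  where "tensor_vec a b = (\<chi> i. a $ fst i * b $ snd i)"

text \<open>The partial trace sums the state over an orthonormal basis of the first factor, so
  positive definiteness passes to the reduced state.\<close>

lemma inner_partial_trace_A:
  "w \<bullet> (partial_trace_A \<rho> *v w) =
    (\<Sum>i\<in>UNIV. tensor_vec (axis i 1) w \<bullet> (\<rho> *v tensor_vec (axis i 1) w))"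
proof -
  have "(\<Sum>k\<in>UNIV. cnj (w $ k) * (partial_trace_A \<rho> *v w) $ k) =
      (\<Sum>i\<in>UNIV. \<Sum>p\<in>UNIV. cnj (tensor_vec (axis i 1) w $ p) * (\<rho> *v tensor_vec (axis i 1) w) $ p)"
    by (simp add: matrix_vector_mult_def partial_trace_A_def tensor_vec_def
        UNIV_2_times_2 UNIV_2 axis_def) (simp add: distrib_left distrib_right add_ac)
  then show ?thesis
    by (simp only: inner_eq_Re_sum Re_sum)
qed

lemma norm_tensor_vec: "(norm (tensor_vec a b))\<^sup>2 = (norm a)\<^sup>2 * (norm b)\<^sup>2"
proof -
  have norm_sq: "(norm v)\<^sup>2 = (\<Sum>i\<in>UNIV. (cmod (v $ i))\<^sup>2)" for v :: "complex ^ 'n"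
    by (simp add: norm_vec_def L2_set_def sum_nonneg)
  show ?thesis
    unfolding norm_sq UNIV_Times_UNIV[symmetric] sum_product sum.cartesian_product
    by (simp add: tensor_vec_def norm_mult power_mult_distrib split_def)
qed

text \<open>If \<open>min_form \<rho>\<close> were positive, the reduced state \<open>S\<close>
  would be positive definite. But for a 2 by 2 matrix twice the determinant is the squared trace
  minus the trace of the square, here \<open>1 - 1\<close>, so \<open>S\<close> is singular.\<close>

lemma min_form_le_0_of_pure_partial_trace:
  assumes \<rho>: "\<rho> \<in> density_matrices"
    and pure: "trace (partial_trace_A \<rho> ** partial_trace_A \<rho>) = 1"
  shows "min_form \<rho> \<le> 0"
proof (rule ccontr)
  assume "\<not> min_form \<rho> \<le> 0"
  define S where "S = partial_trace_A \<rho>"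
  have pos: "0 < w \<bullet> (S *v w)" if "w \<noteq> 0" for w
  proof -
    have "0 < tensor_vec (axis i 1) w \<bullet> (\<rho> *v tensor_vec (axis i 1) w)" for i
    proof -
      have "0 < (norm (tensor_vec (axis i 1) w))\<^sup>2"
        using that by (simp add: norm_tensor_vec axis_eq_0_iff)
      then show ?thesis
        using min_form_le[of \<rho> "tensor_vec (axis i 1) w"] \<open>\<not> min_form \<rho> \<le> 0\<close>
        by (smt (verit) mult_pos_pos)
    qed
    then show ?thesis
      unfolding S_def inner_partial_trace_A by (intro sum_pos) auto
  qed
  have S_herm: "S $ j $ i = cnj (S $ i $ j)" for i j
    unfolding S_def partial_trace_A_def vec_lambda_beta cnj_sum
    by (intro sum.cong refl hermitian_entry density_matrix_hermitian \<rho>)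
  then have "S $ 1 $ 1 \<in> \<real>" "S $ 2 $ 2 \<in> \<real>"
    by (metis Reals_cnj_iff)+
  then obtain p q where p: "S $ 1 $ 1 = of_real p" and q: "S $ 2 $ 2 = of_real q"
    by (auto elim!: Reals_cases)
  define z where "z = S $ 1 $ 2"
  have S12: "S $ 1 $ 2 = z" and S21: "S $ 2 $ 1 = cnj z"
    using S_herm[of 2 1] by (simp_all add: z_def)
  have "trace S = trace \<rho>"
    by (simp add: S_def trace_def partial_trace_A_def UNIV_2 UNIV_2_times_2)
  also have "\<dots> = 1"
    using \<rho> by (simp add: density_matrices_def)
  finally have "of_real (p + q) = (1 :: complex)"
    using p q by (simp add: trace_def UNIV_2)
  then have "p + q = 1"
    by (metis of_real_eq_1_iff)
  have "trace (S ** S) = of_real (p\<^sup>2 + q\<^sup>2 + 2 * (cmod z)\<^sup>2)"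
    unfolding of_real_add of_real_mult complex_norm_square
    by (simp add: trace_def matrix_matrix_mult_def UNIV_2 p q S12 S21 power2_eq_square)
  then have "p\<^sup>2 + q\<^sup>2 + 2 * (cmod z)\<^sup>2 = 1"
    using pure unfolding S_def[symmetric] by (metis of_real_eq_1_iff)
  \<comment> \<open>Comparing the squared trace with the trace of the square gives the vanishing of
    the determinant, \<open>p * q = (cmod z)\<^sup>2\<close>.\<close>
  moreover have "p\<^sup>2 + q\<^sup>2 + 2 * (p * q) = 1"
    using \<open>p + q = 1\<close> power2_sum[of p q] by simp
  ultimately have "p * q = (cmod z)\<^sup>2"
    by linarith
  then have det: "cnj z * z = of_real q * of_real p"
    by (metis complex_norm_square of_real_mult mult.commute)
  \<comment> \<open>A kernel vector of \<open>S\<close>, nonzero because \<open>p > 0\<close>.\<close>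
  define w :: "complex ^ 2" where "w = vector [z, - of_real p]"
  have "axis 1 1 \<noteq> (0 :: complex ^ 2)"
    by (simp add: axis_eq_0_iff)
  from pos[OF this] have "0 < p"
    using p by (simp add: inner_eq_Re_sum UNIV_2 matrix_vector_mult_def axis_def)
  then have "w \<noteq> 0"
    by (auto simp: w_def vec_eq_iff forall_2)
  moreover have "S *v w = 0"
    by (simp add: w_def vec_eq_iff forall_2 matrix_vector_mult_def UNIV_2 p q S12 S21 det
        mult.commute[of z "of_real p"])
  ultimately show False
    using pos[of w] by simp
qed

theorem corollary1:
  fixes hA0 hB :: qubit_op and hA :: "3 \<Rightarrow> qubit_op" and HI :: two_qubit_op
    and \<l> :: "nat \<Rightarrow> qubit_op" and n :: nat
    and \<Lambda> :: "15 \<Rightarrow> two_qubit_op" and \<rho>\<^sub>0 \<rho>\<^sub>T :: two_qubit_op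
  assumes "hA0 \<in> traceless_hermitian" and "\<And>j. hA j \<in> traceless_hermitian"
    and "hB \<in> traceless_hermitian" and "HI \<in> traceless_hermitian_tensor"
    and "\<And>k. k < n \<Longrightarrow> trace (\<l> k) = 0"
    and "orthonormal_basis_traceless_hermitian \<Lambda>"
    and "\<rho>\<^sub>0 \<in> density_matrices" and "\<rho>\<^sub>T \<in> density_matrices"
    and "coherence_vector \<Lambda> \<rho>\<^sub>0 \<in>
      top_of_set coherence_hyperplane interior_of (coherence_vector \<Lambda> ` density_matrices)"
    and "trace (partial_trace_A \<rho>\<^sub>T ** partial_trace_A \<rho>\<^sub>T) = 1"
  shows "\<nexists>T u. 0 \<le> T \<and> essentially_bounded_on {0..T} u \<and>
    steers T (\<lambda>v. master_rhs (hamiltonian hA0 hA HI hB v) n (\<lambda>k. tensor_op (\<l> k) (mat 1)))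
      u \<rho>\<^sub>0 \<rho>\<^sub>T"
proof
  assume "\<exists>T u. 0 \<le> T \<and> essentially_bounded_on {0..T} u \<and>
    steers T (\<lambda>v. master_rhs (hamiltonian hA0 hA HI hB v) n (\<lambda>k. tensor_op (\<l> k) (mat 1)))
      u \<rho>\<^sub>0 \<rho>\<^sub>T"
  then obtain T u x where "0 \<le> T" and x: "x 0 = \<rho>\<^sub>0" "x T = \<rho>\<^sub>T"
    and sol: "caratheodory_solution T
      (\<lambda>t. master_rhs (hamiltonian hA0 hA HI hB (u t)) n (\<lambda>k. tensor_op (\<l> k) (mat 1))) x"
    unfolding steers_def by blast
  have "0 < min_form (x T)"
    using min_form_pos_preserved[OF \<open>0 \<le> T\<close> hermitian_hamiltonian sol]
      min_form_pos_of_interior[of \<Lambda> \<rho>\<^sub>0] assms x by simp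
  then show False
    using min_form_le_0_of_pure_partial_trace[of \<rho>\<^sub>T] assms x by simp
qed

end
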